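(* Let $n\geq 2$ and let $f=1^{x_{1}}0^{y_{1}}1^{x_{2}}0^{y_{2}}\cdots 1^{x_{n}}0^{y_{n}}$ with integers $x_i\geq 1$, $y_i\geq 1$ for $i=1,\ldots,n$. If $x_{n}\geq x_{1}+2$ and $y_{1}\geq y_{n}+2$, then $Q_{d}(f)\not\hookrightarrow Q_{d}$ for all $d\geq 2\sum_{i=2}^{n}x_{i}+2\sum_{i=1}^{n-1}y_{i}+x_{1}+y_{n}-2$.
   Context: All strings are binary; $1^a$ (resp. $0^a$) denotes the string of $a$ consecutive ones (resp. zeros), and juxtaposition is concatenation. $Q_d$ is the $d$-dimensional hypercube: its vertices are the binary strings of length $d$, two being adjacent iff they differ in exactly one bit. A string $f$ is a factor of $\mu$ if $f$ appears as $|f|$ consecutive bits of $\mu$. The generalized Fibonacci cube $Q_d(f)$ is the subgraph of $Q_d$ induced by all strings of length $d$ that do not contain $f$ as a factor. A subgraph $H$ of a connected graph $G$ is an isometric subgraph, written $H\hookrightarrow G$ (and $H\not\hookrightarrow G$ otherwise), if $d_H(\mu,\nu)=d_G(\mu,\nu)$ for all $\mu,\nu\in V(H)$ (with $d_H=\infty$ for vertices in different components of $H$). *)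

theory Defs
  imports "Graph_Theory.Graph_Theory" "HOL-Library.Sublist"
begin

text \<open>
  Binary strings are boolean lists, with \<^const>\<open>True\<close> for the bit 1. Undirected graphs are
  represented by symmetric digraphs whose arcs are ordered pairs of vertices.
\<close>

definition hypercube :: "nat \<Rightarrow> (bool list, bool list \<times> bool list) pre_digraph" where
  "hypercube d = with_proj
    \<lparr> pverts = {u. length u = d},
      parcs = {(u, v). length u = d \<and> length v = d \<and> card {i. i < d \<and> u ! i \<noteq> v ! i} = 1} \<rparr>"

definition avoiding_strings :: "nat \<Rightarrow> bool list \<Rightarrow> bool list set" where
  "avoiding_strings d f = {u. length u = d \<and> \<not> sublist f u}"

definition gen_fib_cube :: "nat \<Rightarrow> bool list \<Rightarrow> (bool list, bool list \<times> bool list) pre_digraph" where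
  "gen_fib_cube d f = hypercube d \<restriction> avoiding_strings d f"

text \<open>
  The number of edges of a shortest walk, i.e. the shortest-path cost for unit arc weights;
  it is \<^term>\<open>\<infinity> :: ereal\<close> if there is no walk.
\<close>

definition graph_dist :: "('a, 'b) pre_digraph \<Rightarrow> 'a \<Rightarrow> 'a \<Rightarrow> ereal" where
  "graph_dist G u v = wf_digraph.\<mu> G (\<lambda>_. 1) u v"

text \<open>
  Connectedness of the host graph, which is usually assumed here, is deliberately not a conjunct:
  its failure must not count as a failure of isometry.
\<close>

definition isometric_subgraph :: "('a, 'b) pre_digraph \<Rightarrow> ('a, 'b) pre_digraph \<Rightarrow> bool" where
  "isometric_subgraph H G \<longleftrightarrow> subgraph H G \<and>
     (\<forall>u \<in> verts H. \<forall>v \<in> verts H. graph_dist H u v = graph_dist G u v)"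

definition block_string :: "nat \<Rightarrow> (nat \<Rightarrow> nat) \<Rightarrow> (nat \<Rightarrow> nat) \<Rightarrow> bool list" where
  "block_string n x y =
     concat (map (\<lambda>i. replicate (x i) True @ replicate (y i) False) [1..<n + 1])"

lemma wf_hypercube: "wf_digraph (hypercube d)"
  by unfold_locales (auto simp: hypercube_def)

lemma symmetric_hypercube: "symmetric (hypercube d)"
proof -
  have "{i. i < d \<and> u ! i \<noteq> v ! i} = {i. i < d \<and> v ! i \<noteq> u ! i}" for u v :: "bool list"
    by auto
  then show ?thesis
    by (auto simp: symmetric_def hypercube_def sym_def)
qed

lemma induced_subgraph_gen_fib_cube: "induced_subgraph (gen_fib_cube d f) (hypercube d)"
  unfolding gen_fib_cube_def
  by (rule wf_digraph.induced_induce[OF wf_hypercube])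
     (auto simp: avoiding_strings_def hypercube_def)

lemma isometric_subgraph_gen_fib_cube_iff:
  "isometric_subgraph (gen_fib_cube d f) (hypercube d) \<longleftrightarrow>
     (\<forall>u \<in> avoiding_strings d f. \<forall>v \<in> avoiding_strings d f.
        graph_dist (gen_fib_cube d f) u v = graph_dist (hypercube d) u v)"
  using induced_subgraph_gen_fib_cube[of d f]
  by (auto simp: isometric_subgraph_def induced_subgraph_def gen_fib_cube_def)

end

theory Submission
  imports Defs
begin

text \<open>
  Put $s = 1^{x_1}$ and $v = 0^{y_n}$. The two inequalities say that $f = A\,s\,11\,v = s\,00\,v\,B$,
  so that two copies of $f$ can be overlapped with exactly two conflicting bits: the word
  $A\,s\,ab\,v\,B$ contains $f$ for $ab = 11$ and for $ab = 00$. For $ab = 10$ and $ab = 01$ it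
  avoids $f$: apart from the extreme offsets, an occurrence at offset $t$ would force the bit of
  $f$ at position $t + |s|$ to be 0 (compare bit $|s|$ with the left copy) and 1 (compare bit
  $|A| + |s|$ with the right copy). The latter two words are at distance 2 in the hypercube, and both of their
  common neighbours contain $f$. Zeros prepended to all four words adjust the dimension, because
  $f$ begins with a one.
\<close>

section \<open>Bit flips, walks, and pairs at distance two\<close>

lemma arc_hypercube_iff:
  "(u, w) \<in> arcs (hypercube d) \<longleftrightarrow> length u = d \<and> (\<exists>i<d. w = u[i := \<not> u ! i])"
proof
  assume "(u, w) \<in> arcs (hypercube d)"
  then have len: "length u = d" "length w = d" and "card {i. i < d \<and> u ! i \<noteq> w ! i} = 1"
    by (auto simp: hypercube_def)
  then obtain i where i: "{i. i < d \<and> u ! i \<noteq> w ! i} = {i}"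
    by (auto simp: card_1_singleton_iff)
  have diff: "k < d \<and> u ! k \<noteq> w ! k \<longleftrightarrow> k = i" for k
    using i by blast
  have "w ! k = u[i := \<not> u ! i] ! k" if "k < d" for k
    using that diff[of k] len by (cases "k = i") auto
  then have "w = u[i := \<not> u ! i]"
    using len by (intro nth_equalityI) simp_all
  with diff[of i] len show "length u = d \<and> (\<exists>i<d. w = u[i := \<not> u ! i])"
    by blast
next
  assume "length u = d \<and> (\<exists>i<d. w = u[i := \<not> u ! i])"
  then obtain i where i: "length u = d" "i < d" "w = u[i := \<not> u ! i]"
    by blast
  then have "{k. k < d \<and> u ! k \<noteq> w ! k} = {i}"
    by (auto simp: nth_list_update)
  with i show "(u, w) \<in> arcs (hypercube d)"
    by (simp add: hypercube_def)
qed

lemma tail_hypercube [simp]: "tail (hypercube d) = fst"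
  and head_hypercube [simp]: "head (hypercube d) = snd"
  and verts_hypercube [simp]: "verts (hypercube d) = {u. length u = d}"
  by (simp_all add: hypercube_def)

lemma gen_fib_cube_simps [simp]:
  "verts (gen_fib_cube d f) = avoiding_strings d f"
  "tail (gen_fib_cube d f) = fst"
  "head (gen_fib_cube d f) = snd"
  "e \<in> arcs (gen_fib_cube d f) \<longleftrightarrow>
     e \<in> arcs (hypercube d) \<and> fst e \<in> avoiding_strings d f \<and> snd e \<in> avoiding_strings d f"
  by (auto simp: gen_fib_cube_def)

lemma wf_gen_fib_cube: "wf_digraph (gen_fib_cube d f)"
  using induced_subgraph_gen_fib_cube[of d f] by (auto simp: induced_subgraph_def subgraph_def)

lemma (in wf_digraph) awalk_cost_unit: "awalk_cost (\<lambda>_. 1) p = real (length p)"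
  by (induction p) auto

text \<open>Two flips join the words in the cube, so their distance there is at most 2. In the
  subgraph every walk between them has at least 3 arcs: the middle vertex of a walk of length 2
  would be one of the two words assumed to contain \<open>f\<close>.\<close>

lemma not_isometric_if_critical_pair:
  assumes u: "u \<in> avoiding_strings d f"
    and w: "u[i := \<not> u ! i, j := \<not> u ! j] \<in> avoiding_strings d f"
    and ij: "i < d" "j < d" "i \<noteq> j"
    and fi: "sublist f (u[i := \<not> u ! i])" and fj: "sublist f (u[j := \<not> u ! j])"
  shows "\<not> isometric_subgraph (gen_fib_cube d f) (hypercube d)"
proof
  let ?w = "u[i := \<not> u ! i, j := \<not> u ! j]"
  let ?G = "hypercube d" and ?H = "gen_fib_cube d f"
  interpret G: wf_digraph ?G by (rule wf_hypercube)
  interpret H: wf_digraph ?H by (rule wf_gen_fib_cube)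
  assume "isometric_subgraph ?H ?G"
  with u w have eq: "graph_dist ?H u ?w = graph_dist ?G u ?w"
    by (simp add: isometric_subgraph_def)
  have len: "length u = d"
    using u by (simp add: avoiding_strings_def)
  let ?z = "u[i := \<not> u ! i]"
  have "(u, ?z) \<in> arcs ?G" "(?z, ?w) \<in> arcs ?G"
    using len ij unfolding arc_hypercube_iff by (auto intro: exI[of _ i] exI[of _ j])
  then have "G.awalk u [(u, ?z), (?z, ?w)] ?w"
    using len by (simp add: G.awalk_simps)
  from G.min_cost_le_walk_cost[OF this, of "\<lambda>_. 1"]
  have "graph_dist ?G u ?w \<le> 2"
    by (simp add: graph_dist_def G.awalk_cost_unit)
  \<comment> \<open>The distance is an infimum over walks, so bounding each walk suffices; this
    includes the case of no walk at all, where the infimum is infinite.\<close>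
  moreover have "3 \<le> graph_dist ?H u ?w"
    unfolding graph_dist_def H.\<mu>_def
  proof (rule INF_greatest)
    fix p assume "p \<in> {p. H.awalk u p ?w}"
    then have p: "H.awalk u p ?w" by simp
    have ui: "u \<noteq> ?w" and not_adj: "(u, ?w) \<notin> arcs ?G"
    proof -
      have di: "?w ! i \<noteq> u ! i" and dj: "?w ! j \<noteq> u ! j"
        using ij len by (auto simp: nth_list_update)
      show "u \<noteq> ?w" using di by metis
      show "(u, ?w) \<notin> arcs ?G"
      proof
        assume "(u, ?w) \<in> arcs ?G"
        then obtain k where "?w = u[k := \<not> u ! k]"
          by (auto simp: arc_hypercube_iff)
        with di dj have "i = k" "j = k"
          by (metis nth_list_update_neq)+
        with ij show False by simp
      qed
    qed
    have no_mid: "\<not> ((u, z) \<in> arcs ?G \<and> (z, ?w) \<in> arcs ?G \<and> z \<in> avoiding_strings d f)" for z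
    proof
      assume z: "(u, z) \<in> arcs ?G \<and> (z, ?w) \<in> arcs ?G \<and> z \<in> avoiding_strings d f"
      then obtain k l where k: "k < d" "z = u[k := \<not> u ! k]" and l: "?w = z[l := \<not> z ! l]"
        by (auto simp: arc_hypercube_iff)
      \<comment> \<open>If the first flip touched neither place, the single flip at \<open>l\<close>
        would have to change both \<open>i\<close> and \<open>j\<close>.\<close>
      have "k = i \<or> k = j"
      proof (rule ccontr)
        assume "\<not> (k = i \<or> k = j)"
        then have "z ! i = u ! i" "z ! j = u ! j"
          using k by auto
        moreover have "?w ! i = (\<not> u ! i)" "?w ! j = (\<not> u ! j)"
          using ij len by auto
        ultimately have "i = l" "j = l"
          using l by (metis nth_list_update_neq)+
        with ij show False by simp
      qed
      with k fi fj have "sublist f z" by auto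
      with z show False by (simp add: avoiding_strings_def)
    qed
    have "length p \<ge> 3"
    proof (rule ccontr)
      assume "\<not> length p \<ge> 3"
      then consider "p = []" | e where "p = [e]" | e e' where "p = [e, e']"
        \<comment> \<open>Only the shape of this rule matters: it splits lists into empty,
          singleton, and at least two elements.\<close>
        by (cases p rule: remdups_adj.cases) (auto simp: not_le less_Suc_eq numeral_3_eq_3)
      then show False
      proof cases
        case 1
        with p ui show False by (simp add: H.awalk_simps)
      next
        case 2
        with p not_adj show False
          by (cases e) (auto simp: H.awalk_simps)
      next
        case 3
        with p no_mid[of "snd e"] show False
          by (cases e, cases e') (auto simp: H.awalk_simps)
      qed
    qed
    then show "3 \<le> ereal (H.awalk_cost (\<lambda>_. 1) p)"
      by (simp add: H.awalk_cost_unit)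
  qed
  ultimately have "(3 :: ereal) \<le> 2"
    using eq by (metis order_trans)
  then show False by simp
qed

section \<open>Overlapping two copies of \<open>f\<close>\<close>

context
  fixes f A B s v :: "bool list"
  assumes left: "f = A @ s @ [True, True] @ v"
    and right: "f = s @ [False, False] @ v @ B"
begin

lemma overlap_length: "length A = length B"
  using arg_cong[OF left, of length] arg_cong[OF right, of length] by simp

text \<open>The zeros come from \<open>right\<close>, the ones from \<open>left\<close>. In the
  overlapped word the left copy starts at 0 and the right copy at \<open>length A\<close>, so these
  are the places of the two middle bits \<open>a\<close> and \<open>b\<close> as seen from either
  copy.\<close>

lemma overlap_nth:
  "f ! length s = False" "f ! Suc (length s) = False"
  "f ! (length A + length s) = True" "f ! Suc (length A + length s) = True"
  by (subst right, simp add: nth_append) (subst right, simp add: nth_append,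
      subst left, simp add: nth_append, subst left, simp add: nth_append)

lemma nth_overlap_left:
  "k < length A + length s \<Longrightarrow> (A @ s @ [a, b] @ v @ B) ! k = f ! k"
  by (subst left) (auto simp: nth_append)

lemma nth_overlap_right:
  assumes "length s + 2 \<le> k"
  shows "(A @ s @ [a, b] @ v @ B) ! (length A + k) = f ! k"
  using assms by (subst right) (simp add: nth_append nth_Cons' not_le)

lemma nth_overlap_mid:
  "(A @ s @ [a, b] @ v @ B) ! (length A + length s) = a"
  "(A @ s @ [a, b] @ v @ B) ! Suc (length A + length s) = b"
  by (simp_all add: nth_append)

lemma sublist_overlapE:
  assumes "sublist f (A @ s @ [a, b] @ v @ B)"
  obtains t where "t \<le> length A"
    and "\<And>i. i < length f \<Longrightarrow> f ! i = (A @ s @ [a, b] @ v @ B) ! (t + i)"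
proof -
  from assms obtain ps ss where eq: "A @ s @ [a, b] @ v @ B = ps @ f @ ss"
    by (auto simp: sublist_def)
  \<comment> \<open>The word is longer than \<open>f\<close> by \<open>length B\<close>, which
    equals \<open>length A\<close>.\<close>
  have "length ps \<le> length A"
    using arg_cong[OF eq, of length] overlap_length arg_cong[OF left, of length] by simp
  then show thesis
  proof (rule that)
    show "f ! i = (A @ s @ [a, b] @ v @ B) ! (length ps + i)" if "i < length f" for i
      unfolding eq using that by (simp add: nth_append)
  qed
qed

lemma not_sublist_overlap_10: "\<not> sublist f (A @ s @ [True, False] @ v @ B)" (is "\<not> sublist f ?W")
proof
  assume "sublist f ?W"
  then obtain t where t: "t \<le> length A" and W: "\<And>i. i < length f \<Longrightarrow> f ! i = ?W ! (t + i)"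
    using sublist_overlapE by blast
  have len: "length f = length A + length s + 2 + length v"
    by (subst left) simp
  note mid = nth_overlap_mid[of True False]
  have "f ! length s = ?W ! (t + length s)"
    using len by (intro W) simp
  \<comment> \<open>At this offset a zero of \<open>f\<close> would land on the first middle bit, a
    one.\<close>
  then have "t \<noteq> length A"
    using overlap_nth mid by auto
  with t have "?W ! (t + length s) = f ! (t + length s)"
    by (intro nth_overlap_left) simp
  with \<open>f ! length s = _\<close> have F: "f ! (t + length s) = False"
    using overlap_nth by simp
  \<comment> \<open>The first of the two ones of \<open>f\<close> lands here; seen from the right
    copy, this is index \<open>t + length s\<close>.\<close>
  have T: "?W ! (length A + (t + length s)) = True"
    using W[of "length A + length s"] overlap_nth len by (simp add: add.left_commute)
  \<comment> \<open>For offsets 0 and 1 a one of \<open>f\<close> would land on the second middle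
    bit, a zero. From offset 2 on, \<open>T\<close> lies beyond the middle bits, where the right
    copy is intact.\<close>
  have "t \<noteq> 0"
    by (rule notI) (use W[of "Suc (length A + length s)"] overlap_nth mid len in auto)
  moreover have "t \<noteq> 1"
    using T by (auto simp: nth_append)
  ultimately show False
    using F T nth_overlap_right[of "t + length s" True False] by simp
qed

lemma not_sublist_overlap_01:
  assumes "length A > 2"
  shows "\<not> sublist f (A @ s @ [False, True] @ v @ B)" (is "\<not> sublist f ?W")
proof
  assume "sublist f ?W"
  then obtain t where t: "t \<le> length A" and W: "\<And>i. i < length f \<Longrightarrow> f ! i = ?W ! (t + i)"
    using sublist_overlapE by blast
  have len: "length f = length A + length s + 2 + length v"
    by (subst left) simp
  note mid = nth_overlap_mid[of False True]
  have "t \<noteq> length A"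
    using W[of "Suc (length s)"] overlap_nth mid len by auto
  with t have F: "f ! (t + length s) = False"
    using W[of "length s"] nth_overlap_left[of "t + length s" False True] overlap_nth len by simp
  have "t \<noteq> 0"
    by (rule notI) (use W[of "length A + length s"] overlap_nth mid len in auto)
  \<comment> \<open>Here the one of \<open>f\<close> at \<open>length A + length s\<close> meets the
    middle one, so another bit must decide. Position \<open>length s + 2\<close> of \<open>f\<close>
    would be 0, by the second zero of \<open>f\<close> and the left copy
    (\<open>length A > 2\<close> keeps it before the middle bits), and 1, by the second one of
    \<open>f\<close> and the right copy.\<close>
  moreover have "t \<noteq> 1"
  proof
    assume "t = 1"
    then have "f ! (length s + 2) = False"
      using W[of "Suc (length s)"] nth_overlap_left[of "length s + 2" False True]
        overlap_nth len assms by simp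
    moreover have "f ! (length s + 2) = True"
      using W[of "Suc (length A + length s)"] nth_overlap_right[of "length s + 2" False True]
        overlap_nth len \<open>t = 1\<close> by simp
    ultimately show False by simp
  qed
  ultimately have "f ! (t + length s) = True"
    using W[of "length A + length s"] nth_overlap_right[of "t + length s" False True]
      overlap_nth len by (simp add: add.left_commute)
  with F show False by simp
qed

end

section \<open>Padding to larger dimensions\<close>

lemma sublist_replicate_append_iff:
  assumes "xs \<noteq> []" "hd xs \<noteq> c"
  shows "sublist xs (replicate k c @ ys) \<longleftrightarrow> sublist xs ys"
proof (induction k)
  case (Suc k)
  with assms show ?case
    by (cases xs) (auto simp: sublist_Cons_right)
qed simp

lemma not_isometric_if_overlap:
  assumes left: "f = A @ s @ [True, True] @ v" and right: "f = s @ [False, False] @ v @ B"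
    and A: "length A > 2" and hd: "hd f = True"
    and d: "d \<ge> length A + length s + 2 + length v + length B"
  shows "\<not> isometric_subgraph (gen_fib_cube d f) (hypercube d)"
proof -
  define k where "k = d - (length A + length s + 2 + length v + length B)"
  define P where "P = replicate k False @ A @ s"
  let ?W = "\<lambda>a b. P @ [a, b] @ v @ B"
  have "f \<noteq> []" using left by simp
  then have sub: "sublist f (?W a b) \<longleftrightarrow> sublist f (A @ s @ [a, b] @ v @ B)" for a b
    using hd sublist_replicate_append_iff[of f False k "A @ s @ [a, b] @ v @ B"]
    by (simp add: P_def)
  have len: "length (?W a b) = d" for a b
    using d by (simp add: P_def k_def)
  define u where "u = ?W True False"
  let ?i = "length P" and ?j = "Suc (length P)"
  have upd: "u[?i := \<not> u ! ?i] = ?W False False" "u[?j := \<not> u ! ?j] = ?W True True"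
    "u[?i := \<not> u ! ?i, ?j := \<not> u ! ?j] = ?W False True"
    by (simp_all add: u_def list_update_append nth_append)
  \<comment> \<open>Behind the padding, middle bits 00 leave \<open>f\<close> as a suffix by
    \<open>right\<close>, and 11 leave it as a prefix by \<open>left\<close>.\<close>
  have "sublist f (u[?i := \<not> u ! ?i])" unfolding upd(1) sub
    by (subst right) (metis append_assoc sublist_append_leftI)
  moreover have "sublist f (u[?j := \<not> u ! ?j])" unfolding upd(2) sub
    by (subst left) (metis append_assoc sublist_append_rightI)
  moreover have "u \<in> avoiding_strings d f"
    using not_sublist_overlap_10[OF left right] sub len
    unfolding u_def avoiding_strings_def by blast
  moreover have "u[?i := \<not> u ! ?i, ?j := \<not> u ! ?j] \<in> avoiding_strings d f"
    using not_sublist_overlap_01[OF left right A] sub len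
    unfolding upd(3) avoiding_strings_def by blast
  moreover have "?i < d" "?j < d" "?i \<noteq> ?j"
    using len[of True False] by simp_all
  ultimately show ?thesis
    by (intro not_isometric_if_critical_pair)
qed

section \<open>The two factorizations of the block string\<close>

lemma length_concat_blocks:
  "length (concat (map (\<lambda>i. replicate (x i) True @ replicate (y i) False) [a..<b])) =
     (\<Sum>i = a..<b. x i + y i)"
  by (simp add: length_concat comp_def interv_sum_list_conv_sum_set_nat)

theorem lemma2p3:
  fixes n d :: nat and x y :: "nat \<Rightarrow> nat"
  assumes "n \<ge> 2"
    and "\<And>i. 1 \<le> i \<Longrightarrow> i \<le> n \<Longrightarrow> x i \<ge> 1"
    and "\<And>i. 1 \<le> i \<Longrightarrow> i \<le> n \<Longrightarrow> y i \<ge> 1"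
    and "x n \<ge> x 1 + 2"
    and "y 1 \<ge> y n + 2"
    and "d \<ge> 2 * (\<Sum>i = 2..n. x i) + 2 * (\<Sum>i = 1..n - 1. y i) + x 1 + y n - 2"
  shows "\<not> isometric_subgraph (gen_fib_cube d (block_string n x y)) (hypercube d)"
proof -
  define g where "g = (\<lambda>i. replicate (x i) True @ replicate (y i) False)"
  \<comment> \<open>The last run of ones is split as a rest, then \<open>x 1\<close> ones, then 11;
    dually, the first run of zeros is 00, then \<open>y n\<close> zeros, then a rest. The two gap
    hypotheses make these subtractions exact.\<close>
  define A where "A = concat (map g [1..<n]) @ replicate (x n - x 1 - 2) True"
  define B where "B = replicate (y 1 - y n - 2) False @ concat (map g [2..<n + 1])"
  let ?f = "block_string n x y" and ?s = "replicate (x 1) True" and ?v = "replicate (y n) False"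
  have f: "?f = concat (map g [1..<n + 1])"
    by (simp add: block_string_def g_def)
  have first: "?f = g 1 @ concat (map g [2..<n + 1])"
    unfolding f using assms(1) by (simp add: upt_conv_Cons numeral_2_eq_2 del: upt_Suc)
  have last: "?f = concat (map g [1..<n]) @ g n"
    unfolding f using assms(1) by simp
  have "replicate (x n) True = replicate (x n - x 1 - 2) True @ ?s @ [True, True]"
    using assms(4) by (intro nth_equalityI) (auto simp: nth_append nth_Cons')
  then have left: "?f = A @ ?s @ [True, True] @ ?v"
    unfolding last A_def g_def by simp
  have "replicate (y 1) False = [False, False] @ ?v @ replicate (y 1 - y n - 2) False"
    using assms(5) by (intro nth_equalityI) (auto simp: nth_append nth_Cons')
  then have right: "?f = ?s @ [False, False] @ ?v @ B"
    unfolding first B_def g_def by simp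
  have x1: "x 1 \<ge> 1" and yn: "y n \<ge> 1"
    using assms(1-3) by auto
  then have hd: "hd ?f = True"
    by (subst first) (simp add: g_def Suc_le_eq hd_append)
  obtain m where m: "n = Suc m" "m \<ge> 1"
    using assms(1) by (cases n) auto
  \<comment> \<open>Both sides are the sum of all \<open>x i\<close>, split at its last and at its
    first term.\<close>
  have Sx: "(\<Sum>i = 1..<n. x i) + x n = x 1 + (\<Sum>i = 2..n. x i)"
    using m sum.atLeast_Suc_atMost[of 1 n x]
    by (simp add: atLeastLessThanSuc_atLeastAtMost numeral_2_eq_2)
  have Sy: "(\<Sum>i = 1..n - 1. y i) = (\<Sum>i = 1..<n. y i)"
    using m by (simp add: atLeastLessThanSuc_atLeastAtMost)
  have y1: "(\<Sum>i = 1..<n. y i) \<ge> y 1" and x1': "(\<Sum>i = 1..<n. x i) \<ge> x 1"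
    using assms(1) member_le_sum[of 1 "{1..<n}" y] member_le_sum[of 1 "{1..<n}" x] by auto
  have lenA: "length A = (\<Sum>i = 1..<n. x i) + (\<Sum>i = 1..<n. y i) + (x n - x 1 - 2)"
    unfolding A_def g_def by (simp add: length_concat_blocks sum.distrib del: length_concat)
  have lenB: "length B = length A"
    using overlap_length[OF left right] by simp
  \<comment> \<open>Already the first block lies in \<open>A\<close>, and \<open>y 1\<close> is at
    least 3.\<close>
  have "length A > 2"
    unfolding lenA using y1 x1 x1' yn assms(5) by linarith
  \<comment> \<open>By \<open>Sx\<close> and \<open>Sy\<close>, \<open>length A\<close> is the sum
    of \<open>x i\<close> over \<open>2..n\<close> plus that of \<open>y i\<close> over
    \<open>1..n - 1\<close>, minus 2. The left side is then exactly the given bound on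
    \<open>d\<close>.\<close>
  moreover have "length A + length ?s + 2 + length ?v + length B \<le> d"
    unfolding lenB lenA using assms(4-6) Sx Sy y1 by (simp del: One_nat_def)
  ultimately show ?thesis
    using left right hd by (intro not_isometric_if_overlap[of ?f A ?s ?v B])
qed

end
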